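(* Let $X$ be a Banach space (real or complex) that contains an infinite-dimensional subspace isomorphic to a subspace of a separable dual Banach space. Then for some $\varepsilon>0$ the unit sphere of $X$ contains a symmetrically $(1+\varepsilon)$-separated sequence. Consequently, the same conclusion holds when $X$ is an infinite-dimensional Banach space with the Radon--Nikodym property or, more generally, when $X$ is an infinite-dimensional Banach space with the point-of-continuity property (PCP).
   Context: For $\delta>0$, a sequence $(x_n)$ in a normed space is symmetrically $\delta$-separated if $\|x_n\pm x_k\|\ge\delta$ (both signs) for all $n\neq k$. A separable dual space is a separable Banach space which is the dual $Y^*$ of some Banach space $Y$. A Banach space $X$ has the point-of-continuity property (PCP) if every non-empty bounded weakly closed subset $A$ of $X$ contains a point at which the identity map from $A$ with the relative weak topology to $A$ with the norm topology is continuous. *)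

theory Defs
  imports "HOL-Analysis.Analysis"
begin

text \<open>
  A field isomorphic, as a normed algebra over the reals, to the real or to the complex numbers.
  The library's classes for normed spaces only know real scalars; this class lets real and complex
  spaces be treated at once.
\<close>

class real_or_complex = real_normed_field +
  assumes real_or_complex:
    "\<exists>e :: 'a \<Rightarrow> complex.
       e 1 = 1 \<and> (\<forall>x y. e (x + y) = e x + e y) \<and> (\<forall>x y. e (x * y) = e x * e y) \<and>
       (\<forall>r x. e (r *\<^sub>R x) = r *\<^sub>R e x) \<and> (\<forall>x. norm (e x) = norm x) \<and>
       (range e = \<real> \<or> range e = UNIV)"

instance real :: real_or_complex
  by standard (rule exI[of _ complex_of_real], auto simp: Reals_def scaleR_conv_of_real)

instance complex :: real_or_complex
  by standard (rule exI[of _ id], auto)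

text \<open>
  A type of class \<^class>\<open>real_normed_vector\<close> whose real structure underlies a normed space over
  \<open>'k\<close> with scalar multiplication \<open>sc\<close>. It is a Banach space over \<open>'k\<close> when the type is of class
  \<^class>\<open>banach\<close>. For real scalars \<open>sc\<close> is necessarily \<open>(*\<^sub>R)\<close>.
\<close>

locale normed_space_over = vector_space sc
  for sc :: "'k::real_or_complex \<Rightarrow> 'x::real_normed_vector \<Rightarrow> 'x" +
  assumes sc_of_real: "sc (of_real r) x = r *\<^sub>R x"
    and norm_sc: "norm (sc c x) = norm c * norm x"

lemma normed_space_over_real: "normed_space_over ((*\<^sub>R) :: real \<Rightarrow> 'x::real_normed_vector \<Rightarrow> 'x)"
  by unfold_locales (auto simp: algebra_simps)

lemma normed_space_over_mult: "normed_space_over ((*) :: 'k::real_or_complex \<Rightarrow> 'k \<Rightarrow> 'k)"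
  by unfold_locales (auto simp: algebra_simps norm_mult scaleR_conv_of_real)

definition infinite_dimensional ::
  "('k::real_or_complex \<Rightarrow> 'x::real_normed_vector \<Rightarrow> 'x) \<Rightarrow> 'x set \<Rightarrow> bool"
  where "infinite_dimensional sc Z \<longleftrightarrow> \<not> (\<exists>B\<subseteq>Z. finite B \<and> Z \<subseteq> module.span sc B)"

definition isomorphic_normed ::
  "('k::real_or_complex \<Rightarrow> 'x::real_normed_vector \<Rightarrow> 'x) \<Rightarrow> 'x set \<Rightarrow>
   ('k \<Rightarrow> 'w::real_normed_vector \<Rightarrow> 'w) \<Rightarrow> 'w set \<Rightarrow> bool"
  where "isomorphic_normed scX Z scW W \<longleftrightarrow>
    (\<exists>T S. homeomorphism Z W T S \<and>
       (\<forall>x\<in>Z. \<forall>y\<in>Z. T (x + y) = T x + T y) \<and>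
       (\<forall>c. \<forall>x\<in>Z. T (scX c x) = scW c (T x)))"

text \<open>
  The type \<open>'x \<Rightarrow>\<^sub>L 'k\<close> consists of the bounded \<^emph>\<open>real\<close>-linear maps, with the operator norm; the dual
  space consists of those that are linear over \<open>'k\<close>.
\<close>

definition dual_space ::
  "('k::real_or_complex \<Rightarrow> 'x::real_normed_vector \<Rightarrow> 'x) \<Rightarrow> ('x \<Rightarrow>\<^sub>L 'k) set"
  where "dual_space sc = {f. \<forall>c x. blinfun_apply f (sc c x) = c * blinfun_apply f x}"

definition dual_scale :: "'k::real_or_complex \<Rightarrow> ('x::real_normed_vector \<Rightarrow>\<^sub>L 'k) \<Rightarrow> ('x \<Rightarrow>\<^sub>L 'k)"
  where "dual_scale c f = blinfun_mult_right c o\<^sub>L f"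

lemma dual_scale_apply: "blinfun_apply (dual_scale c f) x = c * blinfun_apply f x"
  by (simp add: dual_scale_def)

lemma vector_space_dual_scale: "vector_space dual_scale"
  by unfold_locales
     (auto intro!: blinfun_eqI simp: dual_scale_apply plus_blinfun.rep_eq algebra_simps)

lemma subspace_dual_space: "module.subspace dual_scale (dual_space sc)"
proof -
  interpret vector_space dual_scale by (rule vector_space_dual_scale)
  show ?thesis
    by (rule subspaceI)
       (auto simp: dual_space_def dual_scale_apply plus_blinfun.rep_eq algebra_simps)
qed

definition weak_topology ::
  "('k::real_or_complex \<Rightarrow> 'x::real_normed_vector \<Rightarrow> 'x) \<Rightarrow> 'x topology"
  where "weak_topology sc =
    topology_generated_by {blinfun_apply f -` U |f U. f \<in> dual_space sc \<and> open U}"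

definition has_PCP :: "('k::real_or_complex \<Rightarrow> 'x::banach \<Rightarrow> 'x) \<Rightarrow> bool"
  where "has_PCP sc \<longleftrightarrow>
    (\<forall>A. A \<noteq> {} \<and> bounded A \<and> closedin (weak_topology sc) A \<longrightarrow>
       (\<exists>a\<in>A. topcontinuous_at (subtopology (weak_topology sc) A) (top_of_set A) id a))"

text \<open>
  The library's Bochner integral is restricted to second countable (hence separable) range types.
  The following is the usual definition for arbitrary normed spaces.
\<close>

definition strongly_measurable :: "'w measure \<Rightarrow> ('w \<Rightarrow> 'x::real_normed_vector) \<Rightarrow> bool"
  where "strongly_measurable M f \<longleftrightarrow>
    (\<exists>s. (\<forall>i. simple_function M (s i)) \<and> (AE \<omega> in M. (\<lambda>i. s i \<omega>) \<longlonglongrightarrow> f \<omega>))"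

definition has_strong_bochner_integral ::
  "'w measure \<Rightarrow> ('w \<Rightarrow> 'x::real_normed_vector) \<Rightarrow> 'x \<Rightarrow> bool"
  where "has_strong_bochner_integral M f I \<longleftrightarrow>
    strongly_measurable M f \<and>
    (\<exists>s. (\<forall>i. Bochner_Integration.simple_bochner_integrable M (s i)) \<and>
         (\<lambda>i. \<integral>\<^sup>+\<omega>. ennreal (norm (f \<omega> - s i \<omega>)) \<partial>M) \<longlonglongrightarrow> 0 \<and>
         (\<lambda>i. Bochner_Integration.simple_bochner_integral M (s i)) \<longlonglongrightarrow> I)"

definition vector_measure :: "'w measure \<Rightarrow> ('w set \<Rightarrow> 'x::real_normed_vector) \<Rightarrow> bool"
  where "vector_measure M G \<longleftrightarrow>
    (\<forall>A :: nat \<Rightarrow> 'w set. range A \<subseteq> sets M \<and> disjoint_family A \<longrightarrow>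
       (\<lambda>i. G (A i)) sums G (\<Union>i. A i))"

definition bounded_variation :: "'w measure \<Rightarrow> ('w set \<Rightarrow> 'x::real_normed_vector) \<Rightarrow> bool"
  where "bounded_variation M G \<longleftrightarrow>
    (\<exists>C. \<forall>P. finite P \<and> P \<subseteq> sets M \<and> partition_on (space M) P \<longrightarrow> (\<Sum>E\<in>P. norm (G E)) \<le> C)"

definition has_RNP_wrt :: "'w measure \<Rightarrow> 'x::banach itself \<Rightarrow> bool"
  where "has_RNP_wrt M (X :: 'x::banach itself) \<longleftrightarrow>
    (\<forall>G :: 'w set \<Rightarrow> 'x.
       vector_measure M G \<and> bounded_variation M G \<and>
       (\<forall>E\<in>sets M. emeasure M E = 0 \<longrightarrow> G E = 0) \<longrightarrow>
       (\<exists>g. (\<exists>I. has_strong_bochner_integral M g I) \<and>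
            (\<forall>E\<in>sets M. has_strong_bochner_integral M (\<lambda>\<omega>. indicator E \<omega> *\<^sub>R g \<omega>) (G E))))"

text \<open>
  One cannot quantify over measure spaces of all types inside a formula, so the finite measure spaces
  here are those whose underlying set is a set of real numbers (with an arbitrary sigma-algebra and
  an arbitrary finite measure on it). They include the unit interval with Lebesgue measure, and by a
  classical theorem the property for that one space already implies it for all finite measure
  spaces. As the property is only used as a hypothesis, the restriction assumes formally less.
\<close>

definition has_RNP :: "'x::banach itself \<Rightarrow> bool"
  where "has_RNP X \<longleftrightarrow> (\<forall>M :: real measure. finite_measure M \<longrightarrow> has_RNP_wrt M X)"

definition symmetrically_separated :: "real \<Rightarrow> (nat \<Rightarrow> 'x::real_normed_vector) \<Rightarrow> bool"
  where "symmetrically_separated \<delta> x \<longleftrightarrow>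
    \<delta> > 0 \<and> (\<forall>n k. n \<noteq> k \<longrightarrow> norm (x n + x k) \<ge> \<delta> \<and> norm (x n - x k) \<ge> \<delta>)"

end

theory Submission
  imports Defs
begin

text \<open>
  The unit sphere of every infinite-dimensional real normed space contains such a sequence. Bounded
  ultrafilters \<open>q\<close> on the space are convolved with one another, and \<open>q\<close> acts on vectors through its
  type \<open>s \<mapsto> lim \<parallel>s + t\<parallel>\<close> for \<open>t \<rightarrow> q\<close>. Call \<open>w\<close> suppressible if leaving it out as the first
  factor of a convolution does not increase types;
  averaging a telescoping sum shows that every \<open>u \<star> (-u)\<close> is suppressible.

  Suppose that no symmetrically \<open>(1+\<epsilon>)\<close>-separated sequence exists. Then \<open>w \<star> (-w)\<close> has the same
  limit norm \<open>\<rho>\<close> as the suppressible \<open>w\<close>. Choose by Zorn's lemma a suppressible \<open>q\<close> of limit norm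
  \<open>\<rho>\<close> with maximal type. As \<open>q \<star> (-q) \<star> (-q) \<star> q\<close> has the same limit norm and a type at least as
  large, the two types agree, so the type of \<open>(-q) \<star> q\<close> is at most that of \<open>q\<close>. Hence one can go on
  subtracting vectors \<open>t\<^sub>1, t\<^sub>2, \<dots>\<close> picked from \<open>q\<close>: the norms of the partial sums \<open>s\<^sub>n\<close> and of the
  vectors \<open>s\<^sub>n + t\<^sub>n\<^sub>+\<^sub>1\<close> stay close to \<open>\<rho>\<close>, and the latter vectors are pairwise separated by almost
  \<open>2\<rho>\<close>.
\<close>

section \<open>Ultrafilters\<close>

definition ultra :: "'a filter \<Rightarrow> bool"
  where "ultra p \<longleftrightarrow> p \<noteq> bot \<and> (\<forall>P. eventually P p \<or> eventually (\<lambda>x. \<not> P x) p)"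

lemma ultraD: "ultra p \<Longrightarrow> p \<noteq> bot" "ultra p \<Longrightarrow> \<not> eventually P p \<Longrightarrow> eventually (\<lambda>x. \<not> P x) p"
  by (auto simp: ultra_def)

lemma not_eventually_ultra:
  assumes "ultra p" shows "(\<not> eventually P p) = eventually (\<lambda>x. \<not> P x) p"
proof
  assume "eventually (\<lambda>x. \<not> P x) p"
  with ultraD(1)[OF assms] show "\<not> eventually P p"
    using eventually_conj[of P p "\<lambda>x. \<not> P x"] by (auto simp: trivial_limit_def)
qed (rule ultraD(2)[OF assms])

text \<open>Zorn's lemma gives a minimal proper filter \<open>U\<close> below \<open>F\<close>.
  Restricting \<open>U\<close> to a set yields \<open>bot\<close> or, by minimality,
  \<open>U\<close> itself.\<close>

lemma ex_ultra_le:
  fixes F :: "'a filter"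
  assumes "F \<noteq> bot"
  shows "\<exists>U\<le>F. ultra U"
proof -
  let ?A = "{G. G \<noteq> bot \<and> G \<le> F}"
  have "\<exists>m\<in>?A. \<forall>a\<in>?A. m \<ge> a \<longrightarrow> a = m"
  proof (rule predicate_Zorn)
    show "partial_order_on ?A (relation_of (\<ge>) ?A)"
      by (rule partial_order_on_relation_ofI) auto
    fix C assume C: "C \<in> Chains (relation_of (\<ge>) ?A)"
    then have sub: "C \<subseteq> ?A" and total: "\<And>a b. a \<in> C \<Longrightarrow> b \<in> C \<Longrightarrow> a \<le> b \<or> b \<le> a"
      by (auto simp: Chains_def relation_of_def)
    have fin: "X = {} \<or> Inf X \<in> X" if "finite X" "X \<subseteq> C" for X
      using that
    proof (induction X)
      case (insert x X)
      show ?case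
      proof (cases "X = {}")
        case False
        with insert have "Inf X \<in> X" by auto
        with insert.prems total[of x "Inf X"] have "x \<le> Inf X \<or> Inf X \<le> x" by auto
        with \<open>Inf X \<in> X\<close> show ?thesis by (auto simp: inf_absorb1 inf_absorb2)
      qed auto
    qed auto
    \<comment> \<open>With \<open>F\<close> inserted, the empty chain has a bound in
      \<open>?A\<close> as well.\<close>
    have "Inf (insert F C) \<noteq> bot"
    proof (rule Inf_filter_not_bot)
      fix X assume X: "X \<subseteq> insert F C" "finite X"
      then have "X - {F} = {} \<or> Inf (X - {F}) \<in> X - {F}" by (intro fin) auto
      moreover have "inf F (Inf (X - {F})) \<noteq> bot"
      proof (cases "X - {F} = {}")
        case True
        then show ?thesis using assms by (simp only: True) simp
      next
        case False
        with \<open>X - {F} = {} \<or> _\<close> X(1) sub have "Inf (X - {F}) \<in> ?A" by blast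
        then show ?thesis by (simp add: inf_absorb2)
      qed
      moreover have "inf F (Inf (X - {F})) \<le> Inf X"
      proof (rule Inf_greatest)
        fix G assume "G \<in> X"
        then show "inf F (Inf (X - {F})) \<le> G"
          by (cases "G = F") (auto intro: le_infI1 le_infI2 Inf_lower)
      qed
      ultimately show "Inf X \<noteq> bot" by (auto simp: bot_unique)
    qed
    then have "Inf (insert F C) \<in> ?A" by (auto intro: le_infI1)
    moreover have "\<forall>a\<in>C. a \<ge> Inf (insert F C)" by (intro ballI Inf_lower insertI2)
    ultimately show "\<exists>u\<in>?A. \<forall>a\<in>C. a \<ge> u" by blast
  qed
  then obtain U where U: "U \<noteq> bot" "U \<le> F" "\<And>G. G \<noteq> bot \<Longrightarrow> G \<le> U \<Longrightarrow> G = U"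
    by (auto intro: order_trans)
  have "eventually P U" if "\<not> eventually (\<lambda>x. \<not> P x) U" for P
  proof -
    have "inf U (principal {x. P x}) \<noteq> bot"
      using that by (simp add: trivial_limit_def eventually_inf_principal)
    then have "inf U (principal {x. P x}) = U" by (intro U) auto
    then have "U \<le> principal {x. P x}" by (metis inf.cobounded2)
    then show ?thesis by (simp add: le_principal)
  qed
  with U show ?thesis unfolding ultra_def by blast
qed

text \<open>Compactness of \<open>{-B..B}\<close> gives a cluster point, and along an ultrafilter a
  cluster point is a limit: if \<open>f\<close> is not eventually inside a neighbourhood, it is
  eventually outside.\<close>

lemma ultra_tendsto_ex:
  fixes f :: "'a \<Rightarrow> real"
  assumes "ultra p" and "eventually (\<lambda>x. \<bar>f x\<bar> \<le> B) p"
  shows "\<exists>l. (f \<longlongrightarrow> l) p"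
proof -
  have "compact {-B..B}" by simp
  moreover have "filtermap f p \<noteq> bot"
    using ultraD(1)[OF assms(1)] by (simp add: filtermap_bot_iff)
  moreover have "eventually (\<lambda>y. y \<in> {-B..B}) (filtermap f p)"
    using assms(2) by (auto simp: eventually_filtermap elim: eventually_mono)
  ultimately obtain l where l: "inf (nhds l) (filtermap f p) \<noteq> bot"
    unfolding compact_filter by blast
  have "(f \<longlongrightarrow> l) p"
  proof (rule topological_tendstoI, rule ccontr)
    fix S assume S: "open S" "l \<in> S" and "\<not> eventually (\<lambda>x. f x \<in> S) p"
    then have "eventually (\<lambda>y. y \<notin> S) (filtermap f p)"
      using ultraD(2)[OF assms(1)] by (auto simp: eventually_filtermap)
    moreover have "eventually (\<lambda>y. y \<in> S) (nhds l)" using S by (rule eventually_nhds_in_open)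
    ultimately have "eventually (\<lambda>_. False) (inf (nhds l) (filtermap f p))"
      unfolding eventually_inf by blast
    with l show False by (simp add: trivial_limit_def)
  qed
  then show ?thesis ..
qed

lemma ultra_filtermap: "ultra p \<Longrightarrow> ultra (filtermap f p)"
  by (auto simp: ultra_def eventually_filtermap filtermap_bot_iff)

lemma ultra_principal: "ultra (principal {a})"
  by (auto simp: ultra_def eventually_principal principal_eq_bot_iff)

text \<open>The bind of the filter monad: the limit of the filters \<open>q c\<close> as
  \<open>c\<close> runs along \<open>U\<close>. It serves twice, for convolutions and for bounds of
  chains in \<open>ex_maximal_type\<close>.\<close>

definition fbind :: "'c filter \<Rightarrow> ('c \<Rightarrow> 'a filter) \<Rightarrow> 'a filter"
  where "fbind U q = Abs_filter (\<lambda>P. eventually (\<lambda>c. eventually P (q c)) U)"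

lemma eventually_fbind: "eventually P (fbind U q) \<longleftrightarrow> eventually (\<lambda>c. eventually P (q c)) U"
  unfolding fbind_def
proof (rule eventually_Abs_filter, rule is_filter.intro)
  fix P Q assume "\<forall>\<^sub>F c in U. eventually P (q c)" "\<forall>\<^sub>F c in U. eventually Q (q c)"
  then show "\<forall>\<^sub>F c in U. \<forall>\<^sub>F x in q c. P x \<and> Q x"
    by eventually_elim (rule eventually_conj)
next
  fix P Q :: "'a \<Rightarrow> bool" assume "\<forall>x. P x \<longrightarrow> Q x" "\<forall>\<^sub>F c in U. eventually P (q c)"
  then show "\<forall>\<^sub>F c in U. eventually Q (q c)"
    by (auto elim!: eventually_mono)
qed simp

lemma ultra_fbind:
  assumes "ultra U" "\<And>c. ultra (q c)" shows "ultra (fbind U q)"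
  unfolding ultra_def trivial_limit_def eventually_fbind
  using assms by (auto simp: not_eventually_ultra[symmetric] ultraD(1))

lemma tendsto_fbind:
  fixes f :: "'a \<Rightarrow> real"
  assumes "\<And>c. (f \<longlongrightarrow> g c) (q c)" and "(g \<longlongrightarrow> l) U"
  shows "(f \<longlongrightarrow> l) (fbind U q)"
proof (rule topological_tendstoI)
  fix S assume S: "open S" "l \<in> S"
  show "eventually (\<lambda>x. f x \<in> S) (fbind U q)"
    unfolding eventually_fbind
    using topological_tendstoD[OF assms(2) S]
    by eventually_elim (rule topological_tendstoD[OF assms(1) S(1)])
qed

text \<open>The invariant \<open>I\<close> on the finite set of earlier terms can hide data that are
  not terms themselves; \<open>sphere_separated_if_suppressible\<close> keeps the current partial
  sum there.\<close>

lemma sequence_extension: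
  assumes init: "I {}"
    and step: "\<And>U. finite U \<Longrightarrow> I U \<Longrightarrow> \<exists>u. D u \<and> (\<forall>v\<in>U. R v u) \<and> I (insert u U)"
  shows "\<exists>u::nat \<Rightarrow> 'a. (\<forall>n. D (u n)) \<and> (\<forall>i j. i < j \<longrightarrow> R (u i) (u j))"
proof -
  have "\<exists>f. \<forall>n::nat. (finite (f n) \<and> I (f n)) \<and>
      (\<exists>u. D u \<and> (\<forall>v\<in>f n. R v u) \<and> f (Suc n) = insert u (f n))"
  proof (rule dependent_nat_choice)
    fix x and n :: nat assume "finite x \<and> I x"
    with step[of x] show "\<exists>y. (finite y \<and> I y) \<and> (\<exists>u. D u \<and> (\<forall>v\<in>x. R v u) \<and> y = insert u x)"
      by blast
  qed (use init in auto)
  then obtain f where "\<forall>n::nat. \<exists>u. D u \<and> (\<forall>v\<in>f n. R v u) \<and> f (Suc n) = insert u (f n)"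
    by blast
  then obtain u where u: "\<And>n. D (u n) \<and> (\<forall>v\<in>f n. R v (u n)) \<and> f (Suc n) = insert (u n) (f n)"
    by metis
  then have mono: "f i \<subseteq> f j" if "i \<le> j" for i j
    using lift_Suc_mono_le[of f, OF _ that] by blast
  have "R (u i) (u j)" if "i < j" for i j
    using u[of i] u[of j] mono[of "Suc i" j] that by auto
  with u show ?thesis by blast
qed

lemma filter_sequence:
  assumes "F \<noteq> bot" "eventually P F" "\<And>s. P s \<Longrightarrow> eventually (R s) F"
  shows "\<exists>x::nat \<Rightarrow> 'a. (\<forall>n. P (x n)) \<and> (\<forall>i j. i < j \<longrightarrow> R (x i) (x j))"
proof (rule sequence_extension[where I = "\<lambda>U. \<forall>v\<in>U. P v"])
  fix U assume U: "finite U" "\<forall>v\<in>U. P v"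
  then have "eventually (\<lambda>u. P u \<and> (\<forall>v\<in>U. R v u)) F"
    using assms by (auto simp: eventually_conj_iff eventually_ball_finite_distrib)
  then obtain u where "P u \<and> (\<forall>v\<in>U. R v u)"
    using eventually_happens'[OF assms(1)] by blast
  with U show "\<exists>u. P u \<and> (\<forall>v\<in>U. R v u) \<and> (\<forall>v\<in>insert u U. P v)" by blast
qed simp

section \<open>Types and convolution of bounded ultrafilters\<close>

definition bounded_ultra :: "'x::real_normed_vector filter \<Rightarrow> bool"
  where "bounded_ultra p \<longleftrightarrow> ultra p \<and> (\<exists>B. eventually (\<lambda>t. norm t \<le> B) p)"

text \<open>A type in the sense of Krivine and Maurey; \<open>type_of p 0\<close> is the limit norm.
  The \<open>Lim\<close> is meaningful for bounded ultrafilters by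
  \<open>tendsto_type_of\<close>.\<close>

definition type_of :: "'x::real_normed_vector filter \<Rightarrow> 'x \<Rightarrow> real"
  where "type_of p s = Lim p (\<lambda>t. norm (s + t))"

text \<open>In a sum \<open>s + t\<close> the second summand goes to its limit first, with
  \<open>s\<close> fixed. So the order of the factors matters, and first factors stand for vectors
  chosen earlier.\<close>

definition conv :: "'x::real_normed_vector filter \<Rightarrow> 'x filter \<Rightarrow> 'x filter"  (infixr \<open>\<star>\<close> 70)
  where "p \<star> q = fbind p (\<lambda>s. filtermap ((+) s) q)"

definition neg :: "'x::real_normed_vector filter \<Rightarrow> 'x filter"
  where "neg p = filtermap uminus p"

lemma eventually_conv: "eventually P (p \<star> q) \<longleftrightarrow> (\<forall>\<^sub>F s in p. \<forall>\<^sub>F t in q. P (s + t))"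
  by (simp add: conv_def eventually_fbind eventually_filtermap)

lemma eventually_neg: "eventually P (neg p) \<longleftrightarrow> (\<forall>\<^sub>F s in p. P (- s))"
  by (simp add: neg_def eventually_filtermap)

lemma conv_assoc: "(p \<star> q) \<star> r = p \<star> (q \<star> r)"
  by (simp add: filter_eq_iff eventually_conv add.assoc)

lemma conv_zero: "p \<star> principal {0} = p"
  by (simp add: filter_eq_iff eventually_conv eventually_principal)

lemma neg_neg [simp]: "neg (neg p) = p"
  by (simp add: filter_eq_iff eventually_neg)

lemma neg_conv: "neg (p \<star> q) = neg p \<star> neg q"
  by (simp add: filter_eq_iff eventually_neg eventually_conv)

lemma bounded_ultra_nonbot: "bounded_ultra p \<Longrightarrow> p \<noteq> bot"
  by (simp add: bounded_ultra_def ultraD(1))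

lemma bounded_ultra_conv:
  assumes "bounded_ultra p" "bounded_ultra q" shows "bounded_ultra (p \<star> q)"
proof -
  obtain B C where B: "\<forall>\<^sub>F t in p. norm t \<le> B" and C: "\<forall>\<^sub>F t in q. norm t \<le> C"
    using assms by (auto simp: bounded_ultra_def)
  from B have "\<forall>\<^sub>F s in p. \<forall>\<^sub>F t in q. norm (s + t) \<le> B + C"
  proof eventually_elim
    case (elim s)
    with C show ?case
      by (auto elim!: eventually_mono intro: norm_triangle_le)
  qed
  moreover have "ultra (p \<star> q)"
    using assms by (auto simp: conv_def bounded_ultra_def intro!: ultra_fbind ultra_filtermap)
  ultimately show ?thesis by (auto simp: bounded_ultra_def eventually_conv)
qed

lemma bounded_ultra_neg: "bounded_ultra p \<Longrightarrow> bounded_ultra (neg p)"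
  by (auto simp: bounded_ultra_def eventually_neg) (simp add: neg_def ultra_filtermap)

lemma bounded_ultra_principal: "bounded_ultra (principal {a})"
  by (auto simp: bounded_ultra_def ultra_principal eventually_principal)

lemma tendsto_type_of:
  assumes "bounded_ultra p"
  shows "((\<lambda>t. norm (s + t)) \<longlongrightarrow> type_of p s) p"
proof -
  obtain B where "\<forall>\<^sub>F t in p. norm t \<le> B" using assms by (auto simp: bounded_ultra_def)
  then have "\<forall>\<^sub>F t in p. \<bar>norm (s + t)\<bar> \<le> norm s + B"
    by eventually_elim (auto intro: norm_triangle_le)
  with assms obtain l where "((\<lambda>t. norm (s + t)) \<longlongrightarrow> l) p"
    using ultra_tendsto_ex unfolding bounded_ultra_def by metis
  then show ?thesis
    unfolding type_of_def using tendsto_Lim[OF bounded_ultra_nonbot[OF assms]] by metis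
qed

lemma type_of_eqI: "bounded_ultra p \<Longrightarrow> ((\<lambda>t. norm (s + t)) \<longlongrightarrow> l) p \<Longrightarrow> type_of p s = l"
  using tendsto_Lim[OF bounded_ultra_nonbot] unfolding type_of_def by blast

lemma type_of_principal: "type_of (principal {a}) s = norm (s + a)"
  by (rule type_of_eqI[OF bounded_ultra_principal])
     (auto intro!: tendsto_eventually simp: eventually_principal)

lemma type_of_bounds:
  assumes "bounded_ultra p" "\<forall>\<^sub>F t in p. norm t \<le> B"
  shows "\<bar>type_of p s\<bar> \<le> norm s + B"
proof -
  have "type_of p s \<le> norm s + B"
    by (rule tendsto_upperbound[OF tendsto_type_of[OF assms(1)]])
       (use assms bounded_ultra_nonbot in \<open>auto elim!: eventually_mono intro: norm_triangle_le\<close>)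
  moreover have "0 \<le> type_of p s"
    by (rule tendsto_lowerbound[OF tendsto_type_of[OF assms(1)]])
       (use assms bounded_ultra_nonbot in auto)
  ultimately show ?thesis by simp
qed

text \<open>The outer limit \<open>l\<close> exists because \<open>p\<close> is ultra. By
  \<open>tendsto_fbind\<close> it is also the limit of the norms along \<open>p \<star> q\<close>,
  and limits are unique.\<close>

lemma tendsto_type_of_conv:
  assumes "bounded_ultra p" "bounded_ultra q"
  shows "((\<lambda>t. type_of q (s + t)) \<longlongrightarrow> type_of (p \<star> q) s) p"
proof -
  obtain B C where B: "\<forall>\<^sub>F t in p. norm t \<le> B" and C: "\<forall>\<^sub>F t in q. norm t \<le> C"
    using assms by (auto simp: bounded_ultra_def)
  from B have "\<forall>\<^sub>F t in p. \<bar>type_of q (s + t)\<bar> \<le> norm s + B + C"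
  proof eventually_elim
    case (elim t)
    with norm_triangle_ineq[of s t] type_of_bounds[OF assms(2) C, of "s + t"] show ?case by simp
  qed
  with assms(1) obtain l where l: "((\<lambda>t. type_of q (s + t)) \<longlongrightarrow> l) p"
    using ultra_tendsto_ex unfolding bounded_ultra_def by metis
  have "((\<lambda>t. norm (s + t)) \<longlongrightarrow> l) (p \<star> q)"
    unfolding conv_def
  proof (rule tendsto_fbind[OF _ l])
    show "((\<lambda>t. norm (s + t)) \<longlongrightarrow> type_of q (s + c)) (filtermap ((+) c) q)" for c
      using tendsto_type_of[OF assms(2), of "s + c"] by (simp add: filterlim_filtermap add.assoc)
  qed
  with l type_of_eqI[OF bounded_ultra_conv[OF assms]] show ?thesis by metis
qed

lemma type_of_neg:
  assumes "bounded_ultra p" shows "type_of (neg p) s = type_of p (- s)"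
proof (rule type_of_eqI[OF bounded_ultra_neg[OF assms]])
  have "norm (- s + t) = norm (s + - t)" for t :: 'a
    by (metis add.inverse_inverse minus_add_distrib norm_minus_cancel)
  then show "((\<lambda>t. norm (s + t)) \<longlongrightarrow> type_of p (- s)) (neg p)"
    using tendsto_type_of[OF assms, of "- s"] by (simp add: neg_def filterlim_filtermap)
qed

section \<open>Suppressible ultrafilters\<close>

definition suppressible :: "'x::real_normed_vector filter \<Rightarrow> bool"
  where "suppressible w \<longleftrightarrow>
    bounded_ultra w \<and> (\<forall>r. bounded_ultra r \<longrightarrow> (\<forall>s. type_of r s \<le> type_of (w \<star> r) s))"

lemma suppressible_bounded_ultra: "suppressible w \<Longrightarrow> bounded_ultra w"
  by (simp add: suppressible_def)

lemma suppressibleD: "suppressible w \<Longrightarrow> bounded_ultra r \<Longrightarrow> type_of r s \<le> type_of (w \<star> r) s"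
  by (simp add: suppressible_def)

lemma suppressible_norm_le: "suppressible w \<Longrightarrow> norm s \<le> type_of w s"
  using suppressibleD[OF _ bounded_ultra_principal[of 0], of w s]
  by (simp add: conv_zero type_of_principal)

lemma suppressible_conv:
  assumes "suppressible p" "suppressible q" shows "suppressible (p \<star> q)"
  unfolding suppressible_def
proof (intro conjI allI impI)
  show "bounded_ultra (p \<star> q)"
    using assms by (simp add: bounded_ultra_conv suppressible_bounded_ultra)
  fix r :: "'a filter" and s assume r: "bounded_ultra r"
  have "type_of r s \<le> type_of (q \<star> r) s" by (rule suppressibleD[OF assms(2) r])
  also have "\<dots> \<le> type_of (p \<star> (q \<star> r)) s"
    by (intro suppressibleD assms bounded_ultra_conv suppressible_bounded_ultra r)
  finally show "type_of r s \<le> type_of ((p \<star> q) \<star> r) s" by (simp add: conv_assoc)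
qed

lemma suppressible_neg:
  assumes "suppressible p" shows "suppressible (neg p)"
  unfolding suppressible_def
proof (intro conjI allI impI)
  have p: "bounded_ultra p" by (rule suppressible_bounded_ultra[OF assms])
  then show "bounded_ultra (neg p)" by (rule bounded_ultra_neg)
  fix r :: "'a filter" and s assume r: "bounded_ultra r"
  have "type_of r s = type_of (neg r) (- s)" by (simp add: type_of_neg r)
  also have "\<dots> \<le> type_of (p \<star> neg r) (- s)"
    by (intro suppressibleD assms bounded_ultra_neg r)
  also have "\<dots> = type_of (neg p \<star> r) s"
    using type_of_neg[OF bounded_ultra_conv[OF p bounded_ultra_neg[OF r]], of s]
    by (simp add: neg_conv)
  finally show "type_of r s \<le> type_of (neg p \<star> r) s" .
qed

text \<open>Vectors \<open>x i\<close> picked from \<open>u\<close> make every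
  \<open>type_of r (s + x i - x j)\<close> with \<open>i < j\<close> almost as small as
  \<open>type_of (u \<star> neg u \<star> r) s\<close>. The average of
  \<open>s + x i - x (Suc i)\<close> over \<open>i < M\<close> telescopes to \<open>s\<close> plus
  \<open>x 0 - x M\<close> divided by \<open>M\<close>, which is close to \<open>s\<close>;
  convexity of the norm then bounds \<open>type_of r s\<close>.\<close>

lemma suppressible_conv_neg:
  fixes u :: "'x::real_normed_vector filter"
  assumes u: "bounded_ultra u" shows "suppressible (u \<star> neg u)"
  unfolding suppressible_def
proof (intro conjI allI impI)
  show "bounded_ultra (u \<star> neg u)" by (intro bounded_ultra_conv bounded_ultra_neg u)
  fix r :: "'x filter" and s assume r: "bounded_ultra r"
  have nr: "bounded_ultra (neg u \<star> r)" by (intro bounded_ultra_conv bounded_ultra_neg u r)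
  obtain B where B: "\<forall>\<^sub>F t in u. norm t \<le> B" using u by (auto simp: bounded_ultra_def)
  show "type_of r s \<le> type_of ((u \<star> neg u) \<star> r) s"
  proof (rule field_le_epsilon)
    fix e :: real assume e: "e > 0"
    \<comment> \<open>Half of \<open>e\<close> is spent on the choice of the \<open>x i\<close>, the
      other half on the telescoping error, \<open>2 * B\<close> divided by \<open>M\<close>.\<close>
    define L where "L = type_of (u \<star> neg u \<star> r) s + e / 2"
    let ?P = "\<lambda>a. type_of (neg u \<star> r) (s + a) < L \<and> norm a \<le> B"
    have "eventually ?P u"
      using order_tendstoD(2)[OF tendsto_type_of_conv[OF u nr, of s], of L] B e
      by (simp add: L_def eventually_conj_iff)
    moreover have "\<forall>\<^sub>F b in u. type_of r (s + a - b) < L" if "?P a" for a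
      using order_tendstoD(2)[OF tendsto_type_of_conv[OF bounded_ultra_neg[OF u] r, of "s + a"], of L]
        that by (simp add: eventually_neg)
    ultimately have "\<exists>x::nat \<Rightarrow> 'x. (\<forall>n. ?P (x n)) \<and>
        (\<forall>i j. i < j \<longrightarrow> type_of r (s + x i - x j) < L)"
      by (rule filter_sequence[OF bounded_ultra_nonbot[OF u]])
    then obtain x :: "nat \<Rightarrow> 'x" where x: "\<And>n. ?P (x n)"
        "\<And>i j. i < j \<Longrightarrow> type_of r (s + x i - x j) < L"
      by blast
    have "B \<ge> 0" using x(1)[of 0] norm_ge_zero[of "x 0"] by linarith
    obtain M :: nat where M: "2 * B / (e / 2) < real M" using reals_Archimedean2 by blast
    moreover have "0 \<le> 2 * B / (e / 2)" using \<open>B \<ge> 0\<close> e by simp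
    ultimately have "M > 0" by linarith
    have le: "real M * norm (s + t) - 2 * B \<le> (\<Sum>i<M. norm ((s + x i - x (Suc i)) + t))" for t
    proof -
      have "(\<Sum>i<M. (s + x i - x (Suc i)) + t) = real M *\<^sub>R (s + t) + (x 0 - x M)"
        by (induction M) (auto simp: algebra_simps)
      then have sum_eq: "(\<Sum>i<M. (s + x i - x (Suc i)) + t) = real M *\<^sub>R (s + t) - (x M - x 0)"
        by (simp only: diff_diff_eq2 add_diff_eq)
      moreover have "real M * norm (s + t) - norm (x M - x 0) \<le>
          norm (real M *\<^sub>R (s + t) - (x M - x 0))"
        using norm_triangle_ineq2[of "real M *\<^sub>R (s + t)" "x M - x 0"] by simp
      moreover have "norm (x M - x 0) \<le> 2 * B"
        using norm_triangle_ineq4[of "x M" "x 0"] x(1)[of 0] x(1)[of M] by auto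
      ultimately have "real M * norm (s + t) - 2 * B \<le> norm (\<Sum>i<M. (s + x i - x (Suc i)) + t)"
        unfolding sum_eq by linarith
      also have "\<dots> \<le> (\<Sum>i<M. norm ((s + x i - x (Suc i)) + t))" by (rule norm_sum)
      finally show ?thesis .
    qed
    have "real M * type_of r s - 2 * B \<le> (\<Sum>i<M. type_of r (s + x i - x (Suc i)))"
      by (rule tendsto_le[OF bounded_ultra_nonbot[OF r] tendsto_sum[OF tendsto_type_of[OF r]]
            tendsto_diff[OF tendsto_mult[OF tendsto_const tendsto_type_of[OF r]] tendsto_const]])
         (intro always_eventually allI le)
    also have "\<dots> \<le> (\<Sum>i<M. L)" by (intro sum_mono less_imp_le x(2)) simp
    finally have "real M * type_of r s \<le> real M * L + 2 * B" by simp
    also have "2 * B < real M * (e / 2)"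
      using M pos_divide_less_eq[of "e / 2" "2 * B" "real M"] e by (simp only: half_gt_zero)
    finally have "real M * type_of r s < real M * (L + e / 2)" by (simp add: distrib_left)
    then show "type_of r s \<le> type_of ((u \<star> neg u) \<star> r) s + e"
      using \<open>M > 0\<close> by (simp add: L_def conv_assoc)
  qed
qed

section \<open>Separated sequences\<close>

definition sphere_separated :: "'x::real_normed_vector itself \<Rightarrow> bool"
  where "sphere_separated X \<longleftrightarrow> (\<exists>\<epsilon>>0. \<exists>x :: nat \<Rightarrow> 'x.
    range x \<subseteq> sphere 0 1 \<and> symmetrically_separated (1 + \<epsilon>) x)"

text \<open>Moving each \<open>x n\<close> radially to the sphere of radius \<open>\<rho>\<close>
  costs at most \<open>\<delta>\<close>, so a separation of \<open>c - 2 * \<delta>\<close> is left,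
  which still exceeds \<open>\<rho>\<close>. The bound \<open>\<delta> \<le> \<rho>\<close> keeps
  all \<open>x n\<close> nonzero.\<close>

lemma sphere_separated_normalize:
  fixes x :: "nat \<Rightarrow> 'x::real_normed_vector"
  assumes norm_x: "\<And>n. \<bar>norm (x n) - \<rho>\<bar> < \<delta>" and "\<delta> \<le> \<rho>" and c: "\<rho> + 2 * \<delta> < c"
    and sep: "\<And>i j. i < j \<Longrightarrow> c < norm (x i + x j) \<and> c < norm (x i - x j)"
  shows "sphere_separated TYPE('x)"
proof -
  have \<rho>: "\<rho> > 0" using norm_x[of 0] \<open>\<delta> \<le> \<rho>\<close> by linarith
  define y where "y n = x n /\<^sub>R norm (x n)" for n
  have pos: "norm (x n) > 0" for n using norm_x[of n] \<open>\<delta> \<le> \<rho>\<close> by linarith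
  have norm_y: "norm (y n) = 1" for n using pos[of n] by (simp add: y_def)
  have near: "norm (x n - \<rho> *\<^sub>R y n) \<le> \<delta>" for n
  proof -
    have "x n = norm (x n) *\<^sub>R y n" using pos[of n] by (simp add: y_def)
    then have "x n - \<rho> *\<^sub>R y n = (norm (x n) - \<rho>) *\<^sub>R y n"
      by (simp only: scaleR_diff_left flip: \<open>x n = norm (x n) *\<^sub>R y n\<close>)
    then have "norm (x n - \<rho> *\<^sub>R y n) = \<bar>norm (x n) - \<rho>\<bar>"
      by (simp only: norm_scaleR norm_y mult_1_right)
    with norm_x[of n] show ?thesis by linarith
  qed
  define \<epsilon> where "\<epsilon> = (c - 2 * \<delta>) / \<rho> - 1"
  have \<epsilon>: "\<epsilon> > 0" using \<rho> c by (simp add: \<epsilon>_def)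
  have "1 + \<epsilon> \<le> norm (y i + y j) \<and> 1 + \<epsilon> \<le> norm (y i - y j)" if "i < j" for i j
  proof -
    have "norm (x i + x j) - norm (\<rho> *\<^sub>R (y i + y j)) \<le>
        norm ((x i - \<rho> *\<^sub>R y i) + (x j - \<rho> *\<^sub>R y j))"
      using norm_triangle_ineq2[of "x i + x j" "\<rho> *\<^sub>R (y i + y j)"]
      by (simp only: scaleR_add_right add_diff_add)
    also have "\<dots> \<le> 2 * \<delta>"
      using norm_triangle_mono[OF near near] by (simp only: mult_2)
    finally have "norm (x i + x j) - norm (\<rho> *\<^sub>R (y i + y j)) \<le> 2 * \<delta>" .
    moreover have "norm (x i - x j) - norm (\<rho> *\<^sub>R (y i - y j)) \<le> 2 * \<delta>"
    proof -
      have "(x i - x j) - \<rho> *\<^sub>R (y i - y j) = (x i - \<rho> *\<^sub>R y i) - (x j - \<rho> *\<^sub>R y j)"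
        by (simp add: algebra_simps)
      with norm_triangle_ineq2[of "x i - x j" "\<rho> *\<^sub>R (y i - y j)"]
        norm_triangle_le_diff[OF add_mono[OF near[of i] near[of j]]]
      show ?thesis by simp
    qed
    moreover have "norm (\<rho> *\<^sub>R (y i + y j)) = norm (y i + y j) * \<rho>"
      "norm (\<rho> *\<^sub>R (y i - y j)) = norm (y i - y j) * \<rho>"
      using \<rho> by (simp_all only: norm_scaleR abs_of_pos mult.commute)
    ultimately have "c - 2 * \<delta> \<le> norm (y i + y j) * \<rho>" "c - 2 * \<delta> \<le> norm (y i - y j) * \<rho>"
      using sep[OF that] by linarith+
    then show ?thesis by (simp add: \<epsilon>_def pos_divide_le_eq[OF \<rho>])
  qed
  note sep_less = this
  have "1 + \<epsilon> \<le> norm (y i + y j) \<and> 1 + \<epsilon> \<le> norm (y i - y j)" if "i \<noteq> j" for i j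
    using that sep_less[of i j] sep_less[of j i]
    by (cases i j rule: linorder_cases) (simp_all add: add.commute norm_minus_commute)
  then have "range y \<subseteq> sphere 0 1" "symmetrically_separated (1 + \<epsilon>) y"
    using \<epsilon> norm_y by (auto simp: symmetrically_separated_def)
  with \<epsilon> show ?thesis
    unfolding sphere_separated_def by (intro exI[of _ \<epsilon>] exI[of _ y] conjI)
qed

text \<open>A sequence picked from \<open>p\<close> has norms near \<open>type_of p 0\<close>, while
  its sums and differences can be kept above any \<open>c\<close> below the limit norms of
  \<open>p \<star> p\<close> and \<open>p \<star> neg p\<close>.\<close>

lemma sphere_separated_if_conv:
  fixes p :: "'x::real_normed_vector filter"
  assumes p: "bounded_ultra p" and "0 < type_of p 0"
    and "type_of p 0 < type_of (p \<star> p) 0" "type_of p 0 < type_of (p \<star> neg p) 0"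
  shows "sphere_separated TYPE('x)"
proof -
  define \<rho> where "\<rho> = type_of p 0"
  obtain c where c: "\<rho> < c" "c < type_of (p \<star> p) 0" "c < type_of (p \<star> neg p) 0"
    using dense[of \<rho> "min (type_of (p \<star> p) 0) (type_of (p \<star> neg p) 0)"] assms
    by (auto simp: \<rho>_def)
  \<comment> \<open>The normalization needs \<open>\<delta> \<le> \<rho>\<close> and, strictly,
    \<open>2 * \<delta> < c - \<rho>\<close>.\<close>
  define \<delta> where "\<delta> = min \<rho> ((c - \<rho>) / 4)"
  have \<delta>: "\<delta> > 0" "\<delta> \<le> \<rho>" "\<delta> \<le> (c - \<rho>) / 4"
    using assms(2) c(1) by (simp_all only: \<delta>_def \<rho>_def min.cobounded1 min.cobounded2) simp
  note np = bounded_ultra_neg[OF p]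
  let ?P = "\<lambda>s. \<bar>norm s - \<rho>\<bar> < \<delta> \<and> c < type_of p s \<and> c < type_of (neg p) s"
  have "\<forall>\<^sub>F s in p. \<bar>norm s - \<rho>\<bar> < \<delta>"
    using tendstoD[OF tendsto_type_of[OF p, of 0] \<delta>(1)] by (simp add: dist_real_def \<rho>_def)
  moreover have "\<forall>\<^sub>F s in p. c < type_of p s"
    using order_tendstoD(1)[OF tendsto_type_of_conv[OF p p, of 0] c(2)] by simp
  moreover have "\<forall>\<^sub>F s in p. c < type_of (neg p) s"
    using order_tendstoD(1)[OF tendsto_type_of_conv[OF p np, of 0] c(3)] by simp
  ultimately have "eventually ?P p" by eventually_elim simp
  moreover have "\<forall>\<^sub>F t in p. c < norm (s + t) \<and> c < norm (s - t)" if "?P s" for s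
    using order_tendstoD(1)[OF tendsto_type_of[OF p, of s], of c]
      order_tendstoD(1)[OF tendsto_type_of[OF np, of s], of c] that
    by (simp add: eventually_conj_iff eventually_neg)
  ultimately have "\<exists>x::nat \<Rightarrow> 'x. (\<forall>n. ?P (x n)) \<and>
      (\<forall>i j. i < j \<longrightarrow> c < norm (x i + x j) \<and> c < norm (x i - x j))"
    by (rule filter_sequence[OF bounded_ultra_nonbot[OF p]])
  then obtain x :: "nat \<Rightarrow> 'x" where "\<And>n. ?P (x n)"
      "\<And>i j. i < j \<Longrightarrow> c < norm (x i + x j) \<and> c < norm (x i - x j)"
    by blast
  with \<delta> c(1) show ?thesis by (intro sphere_separated_normalize[of x \<rho> \<delta> c]) auto
qed

text \<open>Suppressing the first factor gives one inequality. If the other failed, differences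
  would be large, so \<open>nosep\<close> would force small sums. Translating \<open>w\<close> by a
  typical vector \<open>a\<close> of \<open>w\<close> then makes the sums large too, while the limit
  norm stays small.\<close>

lemma type_of_conv_neg_self:
  fixes w :: "'x::real_normed_vector filter"
  assumes w: "suppressible w" and pos: "0 < type_of w 0" and nosep: "\<not> sphere_separated TYPE('x)"
  shows "type_of (w \<star> neg w) 0 = type_of w 0"
proof (rule antisym)
  note bw = suppressible_bounded_ultra[OF w]
  note bn = bounded_ultra_neg[OF bw]
  define \<rho> where "\<rho> = type_of w 0"
  show "type_of w 0 \<le> type_of (w \<star> neg w) 0"
    using suppressibleD[OF w bn, of 0] by (simp add: type_of_neg bw)
  show "type_of (w \<star> neg w) 0 \<le> type_of w 0"
  proof (rule ccontr)
    assume "\<not> ?thesis"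
    then have gt: "\<rho> < type_of (w \<star> neg w) 0" by (simp add: \<rho>_def)
    with sphere_separated_if_conv[OF bw pos] nosep have le: "type_of (w \<star> w) 0 \<le> \<rho>"
      by (force simp: \<rho>_def)
    \<comment> \<open>As \<open>type_of w a\<close> tends to a value at most \<open>\<rho>\<close>
      and \<open>norm a\<close> tends to \<open>\<rho>\<close>, the factors 3/2 and 3/4 leave room
      on both sides and give \<open>type_of w a < 2 * norm a\<close>.\<close>
    have "\<forall>\<^sub>F a in w. type_of w a < min (type_of (w \<star> neg w) 0) (3 / 2 * \<rho>)"
      using order_tendstoD(2)[OF tendsto_type_of_conv[OF bw bw, of 0],
          of "min (type_of (w \<star> neg w) 0) (3 / 2 * \<rho>)"] gt le pos by (simp add: \<rho>_def)
    moreover have "\<forall>\<^sub>F a in w. 3 / 4 * \<rho> < norm a"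
      using order_tendstoD(1)[OF tendsto_type_of[OF bw, of 0], of "3 / 4 * \<rho>"] pos
      by (simp add: \<rho>_def)
    ultimately have "\<forall>\<^sub>F a in w. type_of w a < type_of (w \<star> neg w) 0 \<and>
        type_of w a < 2 * norm a \<and> 0 < norm a"
      by eventually_elim (use pos in \<open>auto simp: \<rho>_def\<close>)
    then obtain a where a: "type_of w a < type_of (w \<star> neg w) 0" "type_of w a < 2 * norm a" "0 < norm a"
      using eventually_happens'[OF bounded_ultra_nonbot[OF bw]] by blast
    txt \<open>Translating \<open>w\<close> by \<open>a\<close> makes the sums large without changing the differences.\<close>
    let ?p = "principal {a} \<star> w"
    have bp: "bounded_ultra ?p" by (intro bounded_ultra_conv bounded_ultra_principal bw)
    have type_translate: "type_of (principal {b} \<star> r) s = type_of r (s + b)"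
      if "bounded_ultra r" for b s :: 'x and r
      using tendsto_type_of_conv[OF bounded_ultra_principal that, of s b]
      by (intro tendsto_unique[OF bounded_ultra_nonbot[OF bounded_ultra_principal]])
         (auto intro!: tendsto_eventually simp: eventually_principal)
    have p0: "type_of ?p 0 = type_of w a" by (simp add: type_translate bw)
    have "neg ?p = principal {- a} \<star> neg w"
      by (simp add: neg_conv) (simp add: neg_def filtermap_principal)
    moreover have "?p \<star> principal {- a} \<star> neg w = w \<star> neg w"
      by (simp add: filter_eq_iff eventually_conv eventually_principal)
    ultimately have "type_of (?p \<star> neg ?p) 0 = type_of (w \<star> neg w) 0" by simp
    \<comment> \<open>\<open>?p \<star> ?p\<close> is \<open>w \<star> w\<close> translated by
      \<open>a + a\<close>; suppressing \<open>w \<star> w\<close> leaves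
      \<open>norm (a + a)\<close>.\<close>
    moreover have "2 * norm a \<le> type_of (?p \<star> ?p) 0"
    proof -
      have "2 * norm a = norm (a + a)" by (simp flip: scaleR_2)
      also have "\<dots> \<le> type_of (w \<star> w) (a + a)"
        by (intro suppressible_norm_le suppressible_conv w)
      also have "\<dots> = type_of (principal {a + a} \<star> w \<star> w) 0"
        by (simp add: type_translate bounded_ultra_conv bw)
      also have "principal {a + a} \<star> w \<star> w = ?p \<star> ?p"
        by (simp add: filter_eq_iff eventually_conv eventually_principal ac_simps)
      finally show ?thesis .
    qed
    moreover have "0 < type_of w a" using a(3) suppressible_norm_le[OF w, of a] by linarith
    ultimately show False using sphere_separated_if_conv[OF bp] a p0 nosep by simp
  qed
qed

text \<open>Zorn's lemma is applied to types, ordered pointwise, since different ultrafilters may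
  have equal types. A chain is bounded by the type of \<open>Q\<close>, the limit of representing
  ultrafilters along an ultrafilter \<open>U\<close> that contains all tails of the chain.\<close>

lemma ex_maximal_type:
  fixes w :: "'x::real_normed_vector filter"
  assumes "suppressible w"
  obtains q :: "'x filter" where "suppressible q" "type_of q 0 = type_of w 0"
    "\<And>q'. suppressible q' \<Longrightarrow> type_of q' 0 = type_of w 0 \<Longrightarrow> type_of q \<le> type_of q' \<Longrightarrow>
      type_of q' = type_of q"
proof -
  define \<rho> where "\<rho> = type_of w 0"
  define A where "A = {q :: 'x filter. suppressible q \<and> type_of q 0 = \<rho>}"
  have "\<exists>m\<in>type_of ` A. \<forall>a\<in>type_of ` A. m \<le> a \<longrightarrow> a = m"
  proof (rule predicate_Zorn)
    show "partial_order_on (type_of ` A) (relation_of (\<le>) (type_of ` A))"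
      by (rule partial_order_on_relation_ofI) auto
    fix C assume "C \<in> Chains (relation_of (\<le>) (type_of ` A))"
    then have sub: "C \<subseteq> type_of ` A" and total: "\<And>a b. a \<in> C \<Longrightarrow> b \<in> C \<Longrightarrow> a \<le> b \<or> b \<le> a"
      by (auto simp: Chains_def relation_of_def)
    show "\<exists>u\<in>type_of ` A. \<forall>a\<in>C. a \<le> u"
    proof (cases "C = {}")
      case True
      then show ?thesis using assms by (auto simp: A_def \<rho>_def)
    next
      case False
      define F where "F = (INF c\<in>C. principal {d\<in>C. c \<le> d})"
      have ev_F: "eventually P F \<longleftrightarrow> (\<exists>c\<in>C. \<forall>d\<in>C. c \<le> d \<longrightarrow> P d)" for P
        unfolding F_def
      proof (subst eventually_INF_base)
        fix a b assume ab: "a \<in> C" "b \<in> C"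
        have "principal {d \<in> C. y \<le> d} \<le> principal {d \<in> C. x \<le> d}" if "x \<le> y" for x y
          using that by auto
        then show "\<exists>x\<in>C. principal {d \<in> C. x \<le> d} \<le>
            inf (principal {d \<in> C. a \<le> d}) (principal {d \<in> C. b \<le> d})"
          using ab total[OF ab] by (meson le_inf_iff order_refl)
      qed (use False in \<open>auto simp: eventually_principal\<close>)
      have "F \<noteq> bot" using False by (auto simp: trivial_limit_def ev_F)
      then obtain U where U: "U \<le> F" "ultra U" using ex_ultra_le by blast
      \<comment> \<open>Outside \<open>C\<close> the value falls back to \<open>w\<close>, because
        \<open>tendsto_fbind\<close> and \<open>ultra_fbind\<close> need their hypotheses for every
        \<open>c\<close>.\<close>
      have "\<forall>c. \<exists>q. q \<in> A \<and> (c \<in> C \<longrightarrow> type_of q = c)"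
        using sub assms by (auto simp: A_def \<rho>_def)
      then obtain q where q: "\<And>c. q c \<in> A" "\<And>c. c \<in> C \<Longrightarrow> type_of (q c) = c"
        by metis
      have sup: "suppressible (q c)" and q0: "type_of (q c) 0 = \<rho>" and bq: "bounded_ultra (q c)" for c
        using q(1)[of c] by (auto simp: A_def suppressible_bounded_ultra)
      define Q where "Q = fbind U q"
      \<comment> \<open>The common limit norm of all \<open>q c\<close> is what makes the limit
        \<open>Q\<close> bounded.\<close>
      have "(norm \<longlongrightarrow> \<rho>) Q"
        unfolding Q_def
      proof (rule tendsto_fbind[OF _ tendsto_const])
        show "(norm \<longlongrightarrow> \<rho>) (q c)" for c
          using tendsto_type_of[OF bq, of 0 c] by (simp add: q0)
      qed
      moreover from order_tendstoD(2)[OF this, of "\<rho> + 1"] have "\<forall>\<^sub>F t in Q. norm t \<le> \<rho> + 1"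
        by (auto elim: eventually_mono)
      ultimately have bQ: "bounded_ultra Q" and Q0: "type_of Q 0 = \<rho>"
      proof -
        have "ultra Q" unfolding Q_def
          using bq by (intro ultra_fbind U) (auto simp: bounded_ultra_def)
        then show b: "bounded_ultra Q"
          using \<open>\<forall>\<^sub>F t in Q. norm t \<le> \<rho> + 1\<close> by (auto simp: bounded_ultra_def)
        show "type_of Q 0 = \<rho>" using \<open>(norm \<longlongrightarrow> \<rho>) Q\<close> by (intro type_of_eqI[OF b]) simp
      qed
      \<comment> \<open>A violation would leave room for a number \<open>m\<close>, and then some
        single \<open>q c\<close> would already violate suppressibility.\<close>
      have "suppressible Q"
        unfolding suppressible_def
      proof (intro conjI allI impI bQ)
        fix r :: "'x filter" and s assume r: "bounded_ultra r"
        show "type_of r s \<le> type_of (Q \<star> r) s"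
        proof (rule ccontr)
          assume "\<not> ?thesis"
          then obtain m where m: "type_of (Q \<star> r) s < m" "m < type_of r s"
            using dense not_le by blast
          from order_tendstoD(2)[OF tendsto_type_of_conv[OF bQ r, of s] m(1)]
          have "\<forall>\<^sub>F c in U. \<forall>\<^sub>F t in q c. type_of r (s + t) < m"
            by (simp add: Q_def eventually_fbind)
          then obtain c where "\<forall>\<^sub>F t in q c. type_of r (s + t) < m"
            using eventually_happens'[OF ultraD(1)[OF U(2)]] by blast
          then have "type_of (q c \<star> r) s \<le> m"
            by (intro tendsto_upperbound[OF tendsto_type_of_conv[OF bq r]])
               (auto elim: eventually_mono simp: bounded_ultra_nonbot[OF bq])
          with m(2) suppressibleD[OF sup r, of s c] show False by linarith
        qed
      qed
      \<comment> \<open>As \<open>U\<close> contains the tail above \<open>c\<close>, a violation at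
        \<open>s\<close> would show up at some \<open>d\<close> in \<open>C\<close> with
        \<open>c \<le> d\<close>.\<close>
      moreover have "c \<le> type_of Q" if "c \<in> C" for c
      proof (rule le_funI, rule ccontr)
        fix s assume "\<not> c s \<le> type_of Q s"
        then obtain m where m: "type_of Q s < m" "m < c s" using dense not_le by blast
        from order_tendstoD(2)[OF tendsto_type_of[OF bQ, of s] m(1)]
        have "\<forall>\<^sub>F d in U. \<forall>\<^sub>F t in q d. norm (s + t) < m"
          by (simp add: Q_def eventually_fbind)
        moreover have "eventually (\<lambda>d. d \<in> C \<and> c \<le> d) U"
          using that by (intro filter_leD[OF U(1)]) (auto simp: ev_F)
        ultimately have "\<forall>\<^sub>F d in U. d \<in> C \<and> c \<le> d \<and> (\<forall>\<^sub>F t in q d. norm (s + t) < m)"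
          by eventually_elim simp
        then obtain d where d: "d \<in> C" "c \<le> d" "\<forall>\<^sub>F t in q d. norm (s + t) < m"
          using eventually_happens'[OF ultraD(1)[OF U(2)]] by blast
        then have "type_of (q d) s \<le> m"
          by (intro tendsto_upperbound[OF tendsto_type_of[OF bq]])
             (auto elim: eventually_mono simp: bounded_ultra_nonbot[OF bq])
        with d q(2)[OF d(1)] m(2) show False by (auto simp: le_fun_def dest: spec[of _ s])
      qed
      ultimately show ?thesis using Q0 by (auto simp: A_def intro!: bexI[of _ "type_of Q"])
    qed
  qed
  then obtain q where "q \<in> A"
    "\<And>q'. q' \<in> A \<Longrightarrow> type_of q \<le> type_of q' \<Longrightarrow> type_of q' = type_of q"
    by blast
  then show ?thesis by (intro that[of q]) (simp_all add: A_def \<rho>_def)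
qed

lemma sphere_separated_if_suppressible:
  fixes w :: "'x::real_normed_vector filter"
  assumes "suppressible w" "0 < type_of w 0"
  shows "sphere_separated TYPE('x)"
proof (rule ccontr)
  assume nosep: "\<not> sphere_separated TYPE('x)"
  define \<rho> where "\<rho> = type_of w 0"
  have \<rho>: "\<rho> > 0" using assms by (simp add: \<rho>_def)
  obtain q :: "'x filter" where q: "suppressible q" "type_of q 0 = \<rho>"
    and max: "\<And>q'. suppressible q' \<Longrightarrow> type_of q' 0 = \<rho> \<Longrightarrow> type_of q \<le> type_of q' \<Longrightarrow>
      type_of q' = type_of q"
    using ex_maximal_type[OF assms(1)] unfolding \<rho>_def by metis
  note nq = suppressible_neg[OF q(1)]
  note bq = suppressible_bounded_ultra[OF q(1)]
  note bnq = suppressible_bounded_ultra[OF nq]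
  define q1 where "q1 = q \<star> neg q"
  have q1: "suppressible q1" "type_of q1 0 = \<rho>"
    using suppressible_conv[OF q(1) nq] type_of_conv_neg_self[OF q(1)] q \<rho> nosep
    by (auto simp: q1_def)
  have q2: "suppressible (q1 \<star> neg q1)" "type_of (q1 \<star> neg q1) 0 = \<rho>"
    using suppressible_conv[OF q1(1) suppressible_neg[OF q1(1)]] type_of_conv_neg_self[OF q1(1)] q1 \<rho> nosep
    by auto
  \<comment> \<open>Suppressing three factors of
    \<open>q \<star> neg q \<star> neg q \<star> q\<close> leaves \<open>q\<close>, so by maximality
    its type is that of \<open>q\<close>. Suppressing only the first two leaves
    \<open>neg q \<star> q\<close>, which yields \<open>shrink\<close>.\<close>
  have eq: "q1 \<star> neg q1 = (q1 \<star> neg q) \<star> q" by (simp add: q1_def neg_conv conv_assoc)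
  have "type_of (q1 \<star> neg q1) = type_of q"
  proof (rule max[OF q2], rule le_funI)
    show "type_of q s \<le> type_of (q1 \<star> neg q1) s" for s
      unfolding eq by (intro suppressibleD suppressible_conv q1 nq bq)
  qed
  moreover have "type_of (neg q \<star> q) s \<le> type_of (q1 \<star> neg q1) s" for s
    unfolding eq conv_assoc by (intro suppressibleD q1 bounded_ultra_conv bnq bq)
  ultimately have shrink: "type_of (neg q \<star> q) s \<le> type_of q s" for s by simp
  \<comment> \<open>Thanks to \<open>shrink\<close>, subtracting a typical \<open>t\<close> keeps
    the type below \<open>K\<close>, so the construction never stops.\<close>
  have ev_type: "\<forall>\<^sub>F t in q. type_of q (s - t) < K" if "type_of q s < K" for s K
    using order_tendstoD(2)[OF tendsto_type_of_conv[OF bnq bq, of s], of K] shrink[of s] that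
    by (simp add: eventually_neg)
  have ev_less: "\<forall>\<^sub>F t in q. norm (s + t) < K" if "type_of q s < K" for s K
    using order_tendstoD(2)[OF tendsto_type_of[OF bq, of s] that] .
  have ev_greater: "\<forall>\<^sub>F t in q. K < norm (s + t) \<and> K < norm (s - t)" if "K < norm s" for s K
    using order_tendstoD(1)[OF tendsto_type_of[OF bq, of s], of K]
      order_tendstoD(1)[OF tendsto_type_of[OF bnq, of s], of K]
      suppressible_norm_le[OF q(1), of s] suppressible_norm_le[OF nq, of s] that
    by (simp add: eventually_neg eventually_conj_iff)
  \<comment> \<open>The separation \<open>2 * a\<close>, which is 9/5 of \<open>\<rho>\<close>, has
    to exceed \<open>\<rho> + 2 * (\<rho> / 10)\<close> in the final normalization.\<close>
  define a where "a = 9 / 10 * \<rho>"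
  define b where "b = 11 / 10 * \<rho>"
  have "a < \<rho>" "\<rho> < b" using \<rho> by (auto simp: a_def b_def)
  have ev_norm: "\<forall>\<^sub>F t in q. a < norm t"
    using order_tendstoD(1)[OF tendsto_type_of[OF bq, of 0], of a] \<open>a < \<rho>\<close> q(2) by simp
  let ?R = "\<lambda>v u. 2 * a < norm (v + u) \<and> 2 * a < norm (v - u)"
  \<comment> \<open>Here \<open>s\<close> is the current partial sum, not a term of the sequence. By
    \<open>ev_greater\<close> its separation from the earlier terms passes to the next term
    \<open>s + t\<close> and to the next partial sum \<open>s - t\<close>.\<close>
  let ?I = "\<lambda>U. \<exists>s. type_of q s < b \<and> a < norm s \<and> (\<forall>v\<in>U. ?R v s)"
  have "\<exists>u::nat \<Rightarrow> 'x. (\<forall>n. \<bar>norm (u n) - \<rho>\<bar> < \<rho> / 10) \<and> (\<forall>i j. i < j \<longrightarrow> ?R (u i) (u j))"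
  proof (rule sequence_extension[where I = ?I])
    have "\<forall>\<^sub>F t in q. type_of q (0 - t) < b \<and> a < norm t"
      using ev_type[of 0 b] ev_norm q(2) \<open>\<rho> < b\<close> by (simp add: eventually_conj_iff)
    then obtain t where "type_of q (0 - t) < b \<and> a < norm t"
      using eventually_happens'[OF bounded_ultra_nonbot[OF bq]] by blast
    then show "?I {}" by (intro exI[of _ "- t"]) auto
  next
    fix U assume U: "finite U" "?I U"
    then obtain s where s: "type_of q s < b" "a < norm s" "\<forall>v\<in>U. ?R v s" by blast
    have "\<forall>\<^sub>F t in q. ?R v (s + t) \<and> ?R v (s - t)" if "v \<in> U" for v
    proof -
      have "2 * a < norm (v + s)" "2 * a < norm (v - s)" using s(3) that by auto
      from ev_greater[OF this(1)] ev_greater[OF this(2)] show ?thesis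
        by eventually_elim (simp add: algebra_simps)
    qed
    then have "\<forall>\<^sub>F t in q. \<forall>v\<in>U. ?R v (s + t) \<and> ?R v (s - t)"
      using U(1) by (simp add: eventually_ball_finite_distrib)
    with ev_type[OF s(1)] ev_less[OF s(1)] ev_greater[OF s(2)] ev_norm
    have "\<forall>\<^sub>F t in q. type_of q (s - t) < b \<and> norm (s + t) < b \<and> a < norm (s + t) \<and>
        a < norm (s - t) \<and> a < norm t \<and> (\<forall>v\<in>U. ?R v (s + t) \<and> ?R v (s - t))"
      by eventually_elim blast
    then obtain t where t: "type_of q (s - t) < b" "norm (s + t) < b" "a < norm (s + t)"
        "a < norm (s - t)" "a < norm t" "\<forall>v\<in>U. ?R v (s + t) \<and> ?R v (s - t)"
      using eventually_happens'[OF bounded_ultra_nonbot[OF bq]] by blast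
    \<comment> \<open>Since \<open>s\<close> and \<open>t\<close> have norm above \<open>a\<close>,
      the new term is separated from the new partial sum, and hence later from all further
      terms.\<close>
    have "(s + t) + (s - t) = 2 *\<^sub>R s" "(s + t) - (s - t) = 2 *\<^sub>R t"
      by (simp_all add: scaleR_2)
    then have "?R (s + t) (s - t)" using s(2) t(5) by simp
    with t have "?I (insert (s + t) U)" by (intro exI[of _ "s - t"]) blast
    moreover have "\<bar>norm (s + t) - \<rho>\<bar> < \<rho> / 10"
      using t(2,3) unfolding a_def b_def abs_less_iff by linarith
    ultimately show "\<exists>u. \<bar>norm u - \<rho>\<bar> < \<rho> / 10 \<and> (\<forall>v\<in>U. ?R v u) \<and> ?I (insert u U)"
      using t(6) by blast
  qed
  then obtain u :: "nat \<Rightarrow> 'x" where "\<And>n. \<bar>norm (u n) - \<rho>\<bar> < \<rho> / 10"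
      "\<And>i j. i < j \<Longrightarrow> ?R (u i) (u j)" by blast
  then have "sphere_separated TYPE('x)"
    using \<rho> by (intro sphere_separated_normalize[of u \<rho> "\<rho> / 10" "2 * a"]) (auto simp: a_def)
  with nosep show False ..
qed

section \<open>Infinite-dimensional spaces\<close>

text \<open>A vector \<open>v\<close> outside the closed set \<open>span B\<close> has positive
  distance \<open>d\<close> from it. This bounds the coefficient of \<open>v\<close>, so the
  coefficients along a convergent sequence are Cauchy.\<close>

lemma closed_span_finite:
  fixes B :: "'x::real_normed_vector set"
  assumes "finite B" shows "closed (span B)"
  using assms
proof (induction B)
  case (insert v B)
  show ?case
  proof (cases "v \<in> span B")
    case True
    then show ?thesis using insert by (simp add: span_redundant)
  next
    case False
    define d where "d = infdist v (span B)"
    have "span B \<noteq> {}" using span_zero by blast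
    then have "d > 0"
      using False insert.IH infdist_pos_not_in_closed[of "span B" v] by (simp add: d_def)
    have coeff: "\<bar>c\<bar> * d \<le> norm (y + c *\<^sub>R v)" if "y \<in> span B" for c y
    proof (cases "c = 0")
      case False
      have "d \<le> dist v (- (inverse c *\<^sub>R y))"
        unfolding d_def by (intro infdist_le span_neg span_scale that)
      then have "\<bar>c\<bar> * d \<le> \<bar>c\<bar> * norm (v + inverse c *\<^sub>R y)"
        by (intro mult_left_mono) (auto simp: dist_norm)
      also have "\<dots> = norm (c *\<^sub>R (v + inverse c *\<^sub>R y))" by simp
      finally show ?thesis using False by (simp add: algebra_simps)
    qed simp
    show ?thesis
    proof (unfold closed_sequential_limits, intro allI impI, elim conjE)
      fix x z assume x: "\<forall>n. x n \<in> span (insert v B)" and lim: "x \<longlonglongrightarrow> z"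
      from x have "\<forall>n. \<exists>k. x n - k *\<^sub>R v \<in> span B" by (simp add: span_insert)
      then obtain c where c: "\<And>n. x n - c n *\<^sub>R v \<in> span B" by metis
      have "Cauchy c"
      proof (rule metric_CauchyI)
        fix e :: real assume "e > 0"
        with \<open>d > 0\<close> LIMSEQ_imp_Cauchy[OF lim] obtain M where
          M: "\<And>m n. m \<ge> M \<Longrightarrow> n \<ge> M \<Longrightarrow> dist (x m) (x n) < e * d"
          unfolding Cauchy_def by (metis mult_pos_pos)
        have "dist (c m) (c n) < e" if "m \<ge> M" "n \<ge> M" for m n
        proof -
          have "(x m - c m *\<^sub>R v) - (x n - c n *\<^sub>R v) \<in> span B" by (intro span_diff c)
          from coeff[OF this, of "c m - c n"] have "\<bar>c m - c n\<bar> * d \<le> dist (x m) (x n)"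
            by (simp add: dist_norm algebra_simps)
          with M[OF that] have "\<bar>c m - c n\<bar> * d < e * d" by simp
          with \<open>d > 0\<close> show ?thesis by (simp add: dist_real_def)
        qed
        then show "\<exists>M. \<forall>m\<ge>M. \<forall>n\<ge>M. dist (c m) (c n) < e" by blast
      qed
      then obtain k where "c \<longlonglongrightarrow> k" by (auto simp: Cauchy_convergent_iff convergent_def)
      with lim have "(\<lambda>n. x n - c n *\<^sub>R v) \<longlonglongrightarrow> z - k *\<^sub>R v" by (intro tendsto_intros)
      with c insert.IH have "z - k *\<^sub>R v \<in> span B" by (meson closed_sequentially)
      then show "z \<in> span (insert v B)" by (auto simp: span_insert)
    qed
  qed
qed simp

text \<open>Riesz's lemma, applied repeatedly to the span of the earlier terms; being within twice
  the distance \<open>d\<close> is what gives the constant 1/2.\<close>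

lemma riesz_sequence:
  assumes inf: "\<And>B :: 'x::real_normed_vector set. finite B \<Longrightarrow> span B \<noteq> UNIV"
  shows "\<exists>x :: nat \<Rightarrow> 'x. (\<forall>n. norm (x n) = 1) \<and> (\<forall>i j. i < j \<longrightarrow> 1 / 2 \<le> norm (x i - x j))"
proof (rule sequence_extension[where I = "\<lambda>_. True"])
  fix U :: "'x set" assume U: "finite U"
  from inf[OF U] obtain z where z: "z \<notin> span U" by blast
  have ne: "span U \<noteq> {}" using span_zero by blast
  define d where "d = infdist z (span U)"
  have d: "d > 0"
    using z ne closed_span_finite[OF U] infdist_pos_not_in_closed[of "span U" z] by (simp add: d_def)
  have "\<exists>y\<in>span U. dist z y < 2 * d"
  proof (rule ccontr)
    assume "\<not> ?thesis"
    then have "2 * d \<le> infdist z (span U)"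
      by (auto simp: infdist_notempty[OF ne] not_less intro!: cINF_greatest ne)
    with d show False by (simp add: d_def)
  qed
  then obtain y where y: "y \<in> span U" "norm (z - y) < 2 * d" by (auto simp: dist_norm)
  have pos: "norm (z - y) > 0" using y z by auto
  define u where "u = (z - y) /\<^sub>R norm (z - y)"
  have "1 / 2 \<le> norm (v - u)" if "v \<in> U" for v
  proof -
    \<comment> \<open>This point of \<open>span U\<close> is chosen so that its difference from
      \<open>z\<close> is a multiple of \<open>u - v\<close>.\<close>
    have "d \<le> dist z (y + norm (z - y) *\<^sub>R v)"
      unfolding d_def using that by (intro infdist_le span_add y span_scale span_base)
    also have "\<dots> = norm (norm (z - y) *\<^sub>R (u - v))"
      using pos by (simp add: u_def dist_norm algebra_simps)
    finally have "d \<le> norm (z - y) * norm (u - v)" by simp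
    also have "\<dots> \<le> 2 * d * norm (u - v)" using y(2) by (intro mult_right_mono) auto
    finally show ?thesis using d by (simp add: norm_minus_commute)
  qed
  moreover have "norm u = 1" using pos by (simp add: u_def)
  ultimately show "\<exists>u. norm u = 1 \<and> (\<forall>v\<in>U. 1 / 2 \<le> norm (v - u)) \<and> True" by blast
qed simp

text \<open>An ultrafilter \<open>u\<close> along a Riesz sequence, finer than
  \<open>sequentially\<close>, gives a suppressible \<open>u \<star> neg u\<close> whose limit norm
  is at least 1/2.\<close>

theorem sphere_separated_infinite_dimensional:
  assumes "\<And>B :: 'x::real_normed_vector set. finite B \<Longrightarrow> span B \<noteq> UNIV"
  shows "sphere_separated TYPE('x)"
proof -
  obtain x :: "nat \<Rightarrow> 'x" where x: "\<And>n. norm (x n) = 1"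
      "\<And>i j. i < j \<Longrightarrow> 1 / 2 \<le> norm (x i - x j)"
    using riesz_sequence[OF assms] by blast
  obtain V :: "nat filter" where V: "V \<le> sequentially" "ultra V"
    using ex_ultra_le[of sequentially] by auto
  define u where "u = filtermap x V"
  have u: "bounded_ultra u"
    using V(2) by (auto simp: bounded_ultra_def u_def ultra_filtermap eventually_filtermap x(1)
        intro!: exI[of _ 1])
  have "1 / 2 \<le> type_of (neg u) (x n)" for n
  proof (rule tendsto_lowerbound[OF tendsto_type_of[OF bounded_ultra_neg[OF u]]])
    have "\<forall>\<^sub>F m in V. 1 / 2 \<le> norm (x n - x m)"
      using x(2) by (intro filter_leD[OF V(1)]) (auto simp: eventually_sequentially intro: exI[of _ "Suc n"])
    then show "\<forall>\<^sub>F t in neg u. 1 / 2 \<le> norm (x n + t)"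
      by (simp add: eventually_neg u_def eventually_filtermap)
  qed (simp add: bounded_ultra_nonbot bounded_ultra_neg u)
  then have "1 / 2 \<le> type_of (u \<star> neg u) 0"
    by (intro tendsto_lowerbound[OF tendsto_type_of_conv[OF u bounded_ultra_neg[OF u]]])
       (simp_all add: bounded_ultra_nonbot u, simp add: u_def eventually_filtermap)
  then show ?thesis
    by (intro sphere_separated_if_suppressible[OF suppressible_conv_neg[OF u]]) simp
qed

text \<open>A finite set spanning over the reals also spans over \<open>'k\<close>, and would bound
  the size of a basis of \<open>Z\<close>.\<close>

lemma infinite_dimensional_real:
  fixes sc :: "'k::real_or_complex \<Rightarrow> 'x::real_normed_vector \<Rightarrow> 'x" and B :: "'x set"
  assumes "normed_space_over sc" and Z: "infinite_dimensional sc Z" and "finite B"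
  shows "real_vector.span B \<noteq> UNIV"
proof
  interpret normed_space_over sc by fact
  assume UNIV: "real_vector.span B = UNIV"
  have "x \<in> span B" for x
  proof -
    have "x \<in> real_vector.span B" by (simp add: UNIV)
    then show ?thesis
    proof (induction rule: real_vector.span_induct_alt)
      case (step c x y)
      have "sc (of_real c) x + y \<in> span B" by (intro span_add span_scale span_base step)
      then show ?case by (simp only: sc_of_real)
    qed (rule span_zero)
  qed
  obtain C where C: "C \<subseteq> Z" "independent C" "Z \<subseteq> span C" using basis_exists[of Z] by metis
  moreover have "finite C"
    using independent_span_bound[OF \<open>finite B\<close> C(2)] \<open>\<And>x. x \<in> span B\<close> by blast
  ultimately show False using Z by (auto simp: infinite_dimensional_def)
qed

theorem corollary1p3:
  fixes scX :: "'k::real_or_complex \<Rightarrow> 'x::banach \<Rightarrow> 'x"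
    and scY :: "'k \<Rightarrow> 'y::banach \<Rightarrow> 'y"
  assumes "normed_space_over scX"
  shows
    "(normed_space_over scY \<and> separable_space (top_of_set (dual_space scY)) \<and>
      (\<exists>Z W. module.subspace scX Z \<and> infinite_dimensional scX Z \<and>
             module.subspace dual_scale W \<and> W \<subseteq> dual_space scY \<and>
             isomorphic_normed scX Z dual_scale W) \<longrightarrow>
      (\<exists>\<epsilon>>0. \<exists>x :: nat \<Rightarrow> 'x.
         range x \<subseteq> sphere 0 1 \<and> symmetrically_separated (1 + \<epsilon>) x)) \<and>
     (infinite_dimensional scX UNIV \<and> has_RNP TYPE('x) \<longrightarrow>
      (\<exists>\<epsilon>>0. \<exists>x :: nat \<Rightarrow> 'x.
         range x \<subseteq> sphere 0 1 \<and> symmetrically_separated (1 + \<epsilon>) x)) \<and>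
     (infinite_dimensional scX UNIV \<and> has_PCP scX \<longrightarrow>
      (\<exists>\<epsilon>>0. \<exists>x :: nat \<Rightarrow> 'x.
         range x \<subseteq> sphere 0 1 \<and> symmetrically_separated (1 + \<epsilon>) x))"
proof -
  \<comment> \<open>Each case supplies such a \<open>Z\<close>: the given subspace in the first,
    \<open>UNIV\<close> in the other two.\<close>
  have "sphere_separated TYPE('x)" if "infinite_dimensional scX Z" for Z
    using infinite_dimensional_real[OF assms that]
    by (intro sphere_separated_infinite_dimensional) blast
  then show ?thesis unfolding sphere_separated_def by blast
qed

end
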